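(* Let $H$, $\{e_j\}_{j\in\mathbb Z}$, $P_m$, $\mathcal A=B_0(H)$, $W=\{W_j\}_{j\in\mathbb Z}$, $U$, $\ell_2(\mathcal A)$, $S_{U,W}$, $\tilde P_{J,m}$ and $m(\cdot)$ be as in the context. Let $J,m\in\mathbb N$. Then (i) implies (ii), where: (i) $\tilde P_{J,m}$ belongs to the closure of $\mathcal P((S_{U,W}^n)_n)$ in $\ell_2(\mathcal A)$. (ii) There exists a strictly increasing sequence $\{n_k\}_k\subseteq\mathbb N$ such that $$\lim_{k\to\infty}m\left(W_{j-n_k+1}^{-1}W_{j-n_k+2}^{-1}\cdots W_j^{-1}\right)=0$$ for all $j\in[J]$.
   Context: $\mathbb N=\{1,2,\dots\}$. For $J\in\mathbb N$, $[J]:=\{-J,-J+1,\dots,J-1,J\}$. $H$ is a separable Hilbert space with an orthonormal basis $\{e_j\}_{j\in\mathbb Z}$; for $m\in\mathbb N$, $P_m$ is the orthogonal projection of $H$ onto $\mathrm{Span}\{e_{-m},\dots,e_m\}$. $B(H)$ is the $C^*$-algebra of bounded operators on $H$ and $\mathcal A:=B_0(H)$ is the $C^*$-algebra of compact operators on $H$. $W=\{W_j\}_{j\in\mathbb Z}$ is a uniformly bounded sequence of invertible operators in $B(H)$ such that $\{W_j^{-1}\}_{j\in\mathbb Z}$ is also uniformly bounded, and $U$ is a unitary operator on $H$. $\ell_2(\mathcal A)$ is the standard right Hilbert module over $\mathcal A$ indexed by $\mathbb Z$: the sequences $x=(x_j)_{j\in\mathbb Z}$ in $\mathcal A$ such that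 $\sum_j x_j^*x_j$ converges in norm in $\mathcal A$, with $\langle x,y\rangle=\sum_j x_j^*y_j$ and norm $\|x\|_2=\|\langle x,x\rangle\|^{1/2}$. $S_{U,W}$ is the bounded linear operator on $\ell_2(\mathcal A)$ given by $(S_{U,W}(y))_\xi:=W_{\xi+1}^{-1}y_{\xi+1}U^*$ for $\xi\in\mathbb Z$ (it is the inverse of the operator $T_{U,W}$ given by $(T_{U,W}(x))_\xi=W_\xi x_{\xi-1}U$). For $R\in B(H)$, $m(R):=\sup\{C>0 : \|Rh\|\geq C\|h\|\text{ for all }h\in H\}$ (here $m(\cdot)$ is a function on operators, not to be confused with the integer $m$). For $J,m\in\mathbb N$, $\tilde P_{J,m}\in\ell_2(\mathcal A)$ is given by $(\tilde P_{J,m})_j=P_m$ for $j\in[J]$ and $(\tilde P_{J,m})_j=0$ otherwise. For a bounded linear operator $T$ on a Banach space $\mathcal X$, $\mathcal P((T^n)_n)$ denotes the set of periodic elements, i.e. of those $x\in\mathcal X$ for which there is $N\in\mathbb N$ with $T^{kN}x=x$ for all $k\in\mathbb N$. *)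

theory Defs
  imports "HOL-Analysis.Analysis"
begin

section \<open>Complex Hilbert spaces\<close>

text \<open>The inner product is linear in the second argument. Positive definiteness and
  \<open>1 *\<^sub>C x = x\<close> follow from \<open>cinner_self\<close> and \<open>scaleR_scaleC\<close>.\<close>

class complex_hilbert = banach +
  fixes scaleC :: "complex \<Rightarrow> 'a \<Rightarrow> 'a" (infixr "*\<^sub>C" 75)
    and cinner :: "'a \<Rightarrow> 'a \<Rightarrow> complex"
  assumes scaleC_add_right: "c *\<^sub>C (x + y) = c *\<^sub>C x + c *\<^sub>C y"
    and scaleC_add_left: "(c + d) *\<^sub>C x = c *\<^sub>C x + d *\<^sub>C x"
    and scaleC_scaleC: "c *\<^sub>C (d *\<^sub>C x) = (c * d) *\<^sub>C x"
    and scaleR_scaleC: "r *\<^sub>R x = complex_of_real r *\<^sub>C x"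
    and cinner_commute: "cinner x y = cnj (cinner y x)"
    and cinner_add_right: "cinner x (y + z) = cinner x y + cinner x z"
    and cinner_scaleC_right: "cinner x (c *\<^sub>C y) = c * cinner x y"
    and cinner_self: "cinner x x = complex_of_real ((norm x)\<^sup>2)"

interpretation complex_module: module "scaleC :: complex \<Rightarrow> 'a \<Rightarrow> 'a::complex_hilbert"
proof
  fix x :: 'a
  show "1 *\<^sub>C x = x"
    using scaleR_scaleC[of 1 x] by simp
qed (simp_all add: scaleC_add_right scaleC_add_left scaleC_scaleC)

abbreviation cspan :: "'h::complex_hilbert set \<Rightarrow> 'h set"
  where "cspan \<equiv> module.span scaleC"

definition orthonormal_basis :: "('i \<Rightarrow> 'h::complex_hilbert) \<Rightarrow> bool"
  where "orthonormal_basis e \<longleftrightarrow>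
    (\<forall>i j. cinner (e i) (e j) = (if i = j then 1 else 0)) \<and> closure (cspan (range e)) = UNIV"

section \<open>Operators\<close>

text \<open>The library type of bounded operators consists of the real-linear ones; \<open>B(H)\<close> is the
  subset of the complex-linear ones, with the norm, composition and topology of that type.\<close>

definition bounded_ops :: "('h::complex_hilbert \<Rightarrow>\<^sub>L 'h) set"
  where "bounded_ops = {T. \<forall>c x. blinfun_apply T (c *\<^sub>C x) = c *\<^sub>C blinfun_apply T x}"

definition compact_ops :: "('h::complex_hilbert \<Rightarrow>\<^sub>L 'h) set"
  where "compact_ops = {T \<in> bounded_ops. compact (closure (blinfun_apply T ` cball 0 1))}"

definition adj :: "('h::complex_hilbert \<Rightarrow>\<^sub>L 'h) \<Rightarrow> ('h \<Rightarrow>\<^sub>L 'h)"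
  where "adj T = (THE S. \<forall>x y. cinner (blinfun_apply S x) y = cinner x (blinfun_apply T y))"

definition invertible_op :: "('h::complex_hilbert \<Rightarrow>\<^sub>L 'h) \<Rightarrow> bool"
  where "invertible_op T \<longleftrightarrow>
    (\<exists>V\<in>bounded_ops. V o\<^sub>L T = id_blinfun \<and> T o\<^sub>L V = id_blinfun)"

definition inv_op :: "('h::complex_hilbert \<Rightarrow>\<^sub>L 'h) \<Rightarrow> ('h \<Rightarrow>\<^sub>L 'h)"
  where "inv_op T = (THE V. V o\<^sub>L T = id_blinfun \<and> T o\<^sub>L V = id_blinfun)"

definition unitary_op :: "('h::complex_hilbert \<Rightarrow>\<^sub>L 'h) \<Rightarrow> bool"
  where "unitary_op U \<longleftrightarrow>
    U \<in> bounded_ops \<and> adj U o\<^sub>L U = id_blinfun \<and> U o\<^sub>L adj U = id_blinfun"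

definition orth_proj :: "'h::complex_hilbert set \<Rightarrow> ('h \<Rightarrow>\<^sub>L 'h)"
  where "orth_proj M =
    (THE P. \<forall>x. blinfun_apply P x \<in> M \<and> (\<forall>y\<in>M. cinner y (x - blinfun_apply P x) = 0))"

text \<open>The supremum is taken in \<open>[0, \<infinity>)\<close>: the inserted \<open>0\<close> makes it \<open>0\<close> for operators
  that are not bounded below, and changes nothing for the others.\<close>

definition lower_bound_op :: "('h::complex_hilbert \<Rightarrow>\<^sub>L 'h) \<Rightarrow> real"
  where "lower_bound_op R = Sup (insert 0 {C. C > 0 \<and> (\<forall>h. norm (blinfun_apply R h) \<ge> C * norm h)})"

section \<open>The standard Hilbert module over the compact operators\<close>

definition l2A :: "(int \<Rightarrow> ('h::complex_hilbert \<Rightarrow>\<^sub>L 'h)) set"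
  where "l2A = {x. (\<forall>j. x j \<in> compact_ops) \<and> (\<lambda>j. adj (x j) o\<^sub>L x j) summable_on UNIV}"

definition l2A_inner ::
    "(int \<Rightarrow> ('h::complex_hilbert \<Rightarrow>\<^sub>L 'h)) \<Rightarrow> (int \<Rightarrow> ('h \<Rightarrow>\<^sub>L 'h)) \<Rightarrow> ('h \<Rightarrow>\<^sub>L 'h)"
  where "l2A_inner x y = (\<Sum>\<^sub>\<infinity>j. adj (x j) o\<^sub>L y j)"

definition l2A_norm :: "(int \<Rightarrow> ('h::complex_hilbert \<Rightarrow>\<^sub>L 'h)) \<Rightarrow> real"
  where "l2A_norm x = sqrt (norm (l2A_inner x x))"

definition l2A_closure ::
    "(int \<Rightarrow> ('h::complex_hilbert \<Rightarrow>\<^sub>L 'h)) set \<Rightarrow> (int \<Rightarrow> ('h \<Rightarrow>\<^sub>L 'h)) set"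
  where "l2A_closure Y = {x \<in> l2A. \<forall>\<epsilon>>0. \<exists>y\<in>Y. l2A_norm (\<lambda>j. y j - x j) < \<epsilon>}"

definition S_op ::
    "('h::complex_hilbert \<Rightarrow>\<^sub>L 'h) \<Rightarrow> (int \<Rightarrow> ('h \<Rightarrow>\<^sub>L 'h)) \<Rightarrow>
      (int \<Rightarrow> ('h \<Rightarrow>\<^sub>L 'h)) \<Rightarrow> (int \<Rightarrow> ('h \<Rightarrow>\<^sub>L 'h))"
  where "S_op U W y = (\<lambda>\<xi>. inv_op (W (\<xi> + 1)) o\<^sub>L y (\<xi> + 1) o\<^sub>L adj U)"

definition P_tilde ::
    "(int \<Rightarrow> 'h::complex_hilbert) \<Rightarrow> nat \<Rightarrow> nat \<Rightarrow> int \<Rightarrow> ('h \<Rightarrow>\<^sub>L 'h)"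
  where "P_tilde e J m = (\<lambda>j. if j \<in> {- int J..int J}
    then orth_proj (cspan (e ` {- int m..int m})) else 0)"

definition periodic_elements :: "'x set \<Rightarrow> ('x \<Rightarrow> 'x) \<Rightarrow> 'x set"
  where "periodic_elements X T = {x \<in> X. \<exists>N\<ge>1. \<forall>k\<ge>1. (T ^^ (k * N)) x = x}"

text \<open>\<open>W_inv_prod W a b\<close> is \<open>W\<^sub>a\<inverse> W\<^sub>a\<^sub>+\<^sub>1\<inverse> \<cdots> W\<^sub>b\<inverse>\<close>, with indices increasing
  from left to right.\<close>

definition W_inv_prod ::
    "(int \<Rightarrow> ('h::complex_hilbert \<Rightarrow>\<^sub>L 'h)) \<Rightarrow> int \<Rightarrow> int \<Rightarrow> ('h \<Rightarrow>\<^sub>L 'h)"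
  where "W_inv_prod W a b = foldr (\<lambda>i R. inv_op (W i) o\<^sub>L R) [a..b] id_blinfun"

end

theory Submission
  imports Defs
begin

text \<open>If \<open>y\<close> is periodic with period \<open>n > 2J\<close> and \<open>\<epsilon>\<close>-close to \<open>P\<close>, the sequence with entries
  \<open>P\<^sub>m\<close> on \<open>[-J, J]\<close>, and \<open>\<bar>j\<bar> \<le> J\<close>, then \<open>y\<^bsub>j-n\<^esub> = R y\<^sub>j U\<^sup>*\<^sup>n\<close>, where \<open>R\<close> is the product of the
  \<open>n\<close> inverse weights ending at index \<open>j\<close>. As \<open>j - n\<close> lies outside \<open>[-J, J]\<close>, evaluating at \<open>U\<^sup>n e\<^sub>0\<close>
  gives \<open>\<parallel>R (y\<^sub>j e\<^sub>0)\<parallel> \<le> \<epsilon>\<close>, while \<open>\<parallel>y\<^sub>j e\<^sub>0\<parallel> \<ge> 1 - \<epsilon>\<close> because \<open>P\<^sub>m e\<^sub>0 = e\<^sub>0\<close>. Multiples of a period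
  are periods, so \<open>n\<close> can be taken arbitrarily large.\<close>

section \<open>The real inner product and adjoints\<close>

text \<open>Bounded linear and bilinear maps of the library are real-linear, so the analysis runs on
  this real inner product, which induces the same norm.\<close>

definition rinner :: "'h::complex_hilbert \<Rightarrow> 'h \<Rightarrow> real"
  where "rinner x y = Re (cinner x y)"

lemma rinner_commute: "rinner x y = rinner y x"
  unfolding rinner_def by (subst cinner_commute) simp

lemma rinner_add_right: "rinner x (y + z) = rinner x y + rinner x z"
  by (simp add: rinner_def cinner_add_right)

lemma rinner_add_left: "rinner (x + y) z = rinner x z + rinner y z"
  using rinner_add_right[of z x y] by (simp add: rinner_commute)

lemma rinner_scaleR_right: "rinner x (r *\<^sub>R y) = r * rinner x y"
  by (simp add: rinner_def scaleR_scaleC cinner_scaleC_right)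

lemma rinner_scaleR_left: "rinner (r *\<^sub>R x) y = r * rinner x y"
  using rinner_scaleR_right[of y r x] by (simp add: rinner_commute)

lemma rinner_self: "rinner x x = (norm x)\<^sup>2"
  by (simp add: rinner_def cinner_self)

lemma norm_add_sq: "(norm (x + y))\<^sup>2 = (norm x)\<^sup>2 + 2 * rinner x y + (norm y)\<^sup>2"
proof -
  have "(norm (x + y))\<^sup>2 = rinner (x + y) (x + y)"
    by (simp add: rinner_self)
  also have "\<dots> = (norm x)\<^sup>2 + 2 * rinner x y + (norm y)\<^sup>2"
    unfolding rinner_add_left rinner_add_right by (simp add: rinner_self rinner_commute[of y x])
  finally show ?thesis .
qed

text \<open>Cauchy-Schwarz. The norm belongs to the class, so its triangle inequality is available;
  squaring it leaves exactly this bound on the cross term.\<close>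

lemma rinner_le_norm: "rinner x y \<le> norm x * norm y"
proof -
  have "(norm (x + y))\<^sup>2 \<le> (norm x + norm y)\<^sup>2"
    by (intro power_mono norm_triangle_ineq) simp
  then show ?thesis
    by (simp add: norm_add_sq power2_sum)
qed

lemma abs_rinner_le_norm: "\<bar>rinner x y\<bar> \<le> norm x * norm y"
  using rinner_le_norm[of x y] rinner_le_norm[of "-x" y] rinner_scaleR_left[of "-1" x y]
  by (simp add: abs_le_iff)

lemma bounded_bilinear_rinner: "bounded_bilinear rinner"
proof
  show "\<exists>K. \<forall>x y::'a. norm (rinner x y) \<le> norm x * norm y * K"
    by (rule exI[of _ 1]) (simp add: abs_rinner_le_norm)
qed (simp_all add: rinner_add_left rinner_add_right rinner_scaleR_left rinner_scaleR_right)

lemma rinner_ext: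
  assumes "\<And>y. rinner x y = rinner x' y"
  shows "x = x'"
proof -
  have "rinner (x - x') (x - x') = 0"
    using assms[of "x - x'"]
    by (simp add: bounded_bilinear.diff_left[OF bounded_bilinear_rinner])
  then show ?thesis by (simp add: rinner_self)
qed

text \<open>This recovers the complex inner product from \<open>rinner\<close>; the sign reflects
  linearity in the second argument.\<close>

lemma Im_cinner: "Im (cinner x y) = - rinner x (\<i> *\<^sub>C y)"
  by (simp add: rinner_def cinner_scaleC_right)

text \<open>The quadratic in \<open>t\<close> has a minimum at 0, so its derivative there vanishes;
  this is the first-order condition at a minimiser.\<close>

lemma linear_coefficient_zero_if_nonneg:
  fixes a b :: real
  assumes "a \<ge> 0" and "\<And>t. 0 \<le> t\<^sup>2 * a + 2 * t * b"
  shows "b = 0"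
proof -
  \<comment> \<open>The choice \<open>t = - b / (a + 1)\<close> is near the vertex; adding 1 covers
    the case \<open>a = 0\<close>.\<close>
  have "0 \<le> (- b / (a + 1))\<^sup>2 * a + 2 * (- b / (a + 1)) * b"
    by (rule assms(2))
  also have "\<dots> = - (b\<^sup>2 * (a + 2)) / (a + 1)\<^sup>2"
    using assms(1) by (simp add: divide_simps) (simp add: power2_eq_square algebra_simps)
  finally have "b\<^sup>2 * (a + 2) \<le> 0"
    using assms(1) by (simp add: divide_simps)
  then show ?thesis
    using assms(1) by (simp add: mult_le_0_iff)
qed

text \<open>The representing vector minimises \<open>\<parallel>x\<parallel>\<^sup>2 - 2 f x\<close>; minimising sequences are Cauchy by the
  parallelogram law.\<close>

lemma riesz_representation:
  fixes f :: "'h::complex_hilbert \<Rightarrow> real"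
  assumes "bounded_linear f"
  obtains z where "\<And>y. f y = rinner z y"
proof -
  interpret f: bounded_linear f by fact
  define g where "g x = (norm x)\<^sup>2 - 2 * f x" for x
  obtain K where K: "\<And>x. norm (f x) \<le> norm x * K"
    using f.bounded by blast
  have lower: "g x \<ge> - K\<^sup>2" for x
  proof -
    have "f x \<le> norm x * K" using K[of x] by simp
    moreover have "0 \<le> (norm x - K)\<^sup>2" by simp
    ultimately show ?thesis
      unfolding g_def by (simp add: power2_diff)
  qed
  define d where "d = Inf (range g)"
  have bdd: "bdd_below (range g)"
    using lower by (auto intro!: bdd_belowI[of _ "- K\<^sup>2"])
  have d_le: "d \<le> g x" for x
    unfolding d_def by (rule cInf_lower[OF _ bdd]) simp
  \<comment> \<open>The left side equals \<open>2 * g x + 2 * g y\<close> minus four times the value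
    of \<open>g\<close> at the midpoint, and that value is at least \<open>d\<close>.\<close>
  have dist_le: "(norm (x - y))\<^sup>2 \<le> 2 * (g x - d) + 2 * (g y - d)" for x y
  proof -
    have "g ((1/2) *\<^sub>R (x + y)) = (norm (x + y))\<^sup>2 / 4 - f x - f y"
      unfolding g_def by (simp add: f.scaleR f.add power_divide add_divide_distrib)
    moreover have "(norm (x - y))\<^sup>2 = 2 * (norm x)\<^sup>2 + 2 * (norm y)\<^sup>2 - (norm (x + y))\<^sup>2"
      using norm_add_sq[of x y] norm_add_sq[of x "-y"] rinner_scaleR_right[of x "-1" y] by simp
    ultimately show ?thesis
      using d_le[of "(1/2) *\<^sub>R (x + y)"] unfolding g_def by simp
  qed
  have "\<exists>x. g x < d + 1 / real (Suc n)" for n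
    using cInf_lessD[of "range g" "d + 1 / real (Suc n)"] unfolding d_def by auto
  then obtain X where X: "\<And>n. g (X n) < d + 1 / real (Suc n)"
    by metis
  have "Cauchy X"
  proof (rule metric_CauchyI)
    fix r :: real assume "r > 0"
    then obtain M where M: "inverse (real (Suc M)) < r\<^sup>2 / 4"
      using reals_Archimedean[of "r\<^sup>2 / 4"] by auto
    have "dist (X i) (X j) < r" if "i \<ge> M" "j \<ge> M" for i j
    proof -
      have small: "g (X l) - d < r\<^sup>2 / 4" if "l \<ge> M" for l
      proof -
        have "1 / real (Suc l) \<le> 1 / real (Suc M)"
          using that by (simp add: divide_simps)
        then show ?thesis
          using X[of l] M by (simp add: inverse_eq_divide)
      qed
      have "(norm (X i - X j))\<^sup>2 < r\<^sup>2"
        using dist_le[of "X i" "X j"] small[OF that(1)] small[OF that(2)] by simp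
      then show ?thesis
        using \<open>r > 0\<close> by (simp add: dist_norm power2_less_imp_less)
    qed
    then show "\<exists>M. \<forall>i\<ge>M. \<forall>j\<ge>M. dist (X i) (X j) < r" by blast
  qed
  then obtain z where z: "X \<longlonglongrightarrow> z"
    using Cauchy_convergent convergent_def by blast
  have "(\<lambda>n. g (X n)) \<longlonglongrightarrow> g z"
    unfolding g_def by (intro tendsto_intros f.tendsto z)
  moreover have "(\<lambda>n. d + 1 / real (Suc n)) \<longlonglongrightarrow> d + 0"
    using LIMSEQ_Suc[OF lim_1_over_n] by (intro tendsto_add tendsto_const) simp
  ultimately have "g z \<le> d + 0"
    by (rule LIMSEQ_le) (use X in \<open>auto intro: less_imp_le\<close>)
  then have min: "g z \<le> g x" for x
    using d_le[of x] by simp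
  have "f y = rinner z y" for y
  proof -
    \<comment> \<open>The right side is the increment of \<open>g\<close> from the minimiser
      \<open>z\<close> to \<open>z + t *\<^sub>R y\<close>.\<close>
    have "0 \<le> t\<^sup>2 * (norm y)\<^sup>2 + 2 * t * (rinner z y - f y)" for t
      using min[of "z + t *\<^sub>R y"] unfolding g_def
      by (simp add: norm_add_sq f.add f.scaleR rinner_scaleR_right power_mult_distrib algebra_simps)
    from linear_coefficient_zero_if_nonneg[OF _ this] show ?thesis by simp
  qed
  then show thesis by (rule that)
qed

text \<open>Complex linearity of \<open>T\<close> lets the real identity be tested at
  \<open>\<i> *\<^sub>C y\<close> as well, which yields the imaginary parts.\<close>

lemma cinner_eq_if_rinner_eq:
  assumes "T \<in> bounded_ops" and "\<And>y. rinner z y = rinner x (blinfun_apply T y)"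
  shows "cinner z y = cinner x (blinfun_apply T y)"
  using assms(2)[of y] assms(2)[of "\<i> *\<^sub>C y"] assms(1)
  by (auto intro!: complex_eqI simp: Im_cinner bounded_ops_def) (simp_all add: rinner_def)

text \<open>The definite description in \<open>adj\<close> needs existence and uniqueness. Riesz
  representation of \<open>y \<mapsto> rinner x (T y)\<close> supplies the first,
  \<open>rinner_ext\<close> the second.\<close>

lemma cinner_adj:
  assumes "T \<in> bounded_ops"
  shows "cinner (blinfun_apply (adj T) x) y = cinner x (blinfun_apply T y)"
proof -
  interpret rinner: bounded_bilinear "rinner :: 'a \<Rightarrow> 'a \<Rightarrow> real"
    by (rule bounded_bilinear_rinner)
  have "\<exists>z. \<forall>y. rinner z y = rinner x (blinfun_apply T y)" for x
  proof -
    have "bounded_linear (\<lambda>y. rinner x (blinfun_apply T y))"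
      by (intro bounded_linear_compose[OF rinner.bounded_linear_right] blinfun.bounded_linear_right)
    from riesz_representation[OF this] show ?thesis by metis
  qed
  then obtain s where s: "\<And>x y. rinner (s x) y = rinner x (blinfun_apply T y)"
    by metis
  have "bounded_linear s"
  proof (rule bounded_linear_intro)
    show "s (x + y) = s x + s y" for x y
      by (rule rinner_ext) (simp add: rinner_add_left s)
    show "s (r *\<^sub>R x) = r *\<^sub>R s x" for r x
      by (rule rinner_ext) (simp add: rinner_scaleR_left s)
    show "norm (s x) \<le> norm x * norm T" for x
    proof -
      have "norm (s x) * norm (s x) = rinner x (blinfun_apply T (s x))"
        using rinner_self[of "s x"] by (simp add: s power2_eq_square)
      also have "\<dots> \<le> norm x * (norm T * norm (s x))"
        by (rule order_trans[OF rinner_le_norm]) (intro mult_left_mono norm_blinfun norm_ge_zero)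
      finally have "norm (s x) * norm (s x) \<le> (norm x * norm T) * norm (s x)"
        by (simp add: mult.assoc)
      then show ?thesis
        by (cases "norm (s x) = 0") (auto dest: mult_right_le_imp_le)
    qed
  qed
  then have S: "blinfun_apply (Blinfun s) x = s x" for x
    by (simp add: bounded_linear_Blinfun_apply)
  have "\<forall>x y. cinner (blinfun_apply (adj T) x) y = cinner x (blinfun_apply T y)"
    unfolding adj_def
  proof (rule theI)
    show "\<forall>x y. cinner (blinfun_apply (Blinfun s) x) y = cinner x (blinfun_apply T y)"
      using cinner_eq_if_rinner_eq[OF assms s] by (simp add: S)
    fix S' assume S': "\<forall>x y. cinner (blinfun_apply S' x) y = cinner x (blinfun_apply T y)"
    show "S' = Blinfun s"
    proof (rule blinfun_eqI)
      fix x
      show "blinfun_apply S' x = blinfun_apply (Blinfun s) x"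
        by (rule rinner_ext) (simp add: S s, simp add: rinner_def S')
    qed
  qed
  then show ?thesis by blast
qed

lemma rinner_adj:
  assumes "T \<in> bounded_ops"
  shows "rinner (blinfun_apply (adj T) x) y = rinner x (blinfun_apply T y)"
  using cinner_adj[OF assms] by (simp add: rinner_def)

lemma unitary_op_apply:
  assumes "unitary_op U"
  shows "blinfun_apply (adj U) (blinfun_apply U x) = x" and "norm (blinfun_apply U x) = norm x"
proof -
  have U: "U \<in> bounded_ops" "adj U o\<^sub>L U = id_blinfun"
    using assms by (simp_all add: unitary_op_def)
  show eq: "blinfun_apply (adj U) (blinfun_apply U x) = x"
    by (metis U(2) blinfun_apply_blinfun_compose id_blinfun.rep_eq id_apply)
  have "(norm (blinfun_apply U x))\<^sup>2 = (norm x)\<^sup>2"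
    using rinner_adj[OF U(1), of "blinfun_apply U x" x] by (simp add: eq rinner_self)
  then show "norm (blinfun_apply U x) = norm x"
    by (simp add: power2_eq_iff_nonneg)
qed

section \<open>Orthogonal projections onto finite-dimensional subspaces\<close>

lemma cinner_add_left: "cinner (x + y) z = cinner x z + cinner y z"
  by (metis cinner_commute cinner_add_right complex_cnj_add)

lemma cinner_scaleC_left: "cinner (c *\<^sub>C x) y = cnj c * cinner x y"
  by (metis cinner_commute cinner_scaleC_right complex_cnj_mult)

lemma cinner_diff_right: "cinner x (y - z) = cinner x y - cinner x z"
  using cinner_add_right[of x "y - z" z] by simp

lemma cinner_zero_left: "cinner 0 y = 0"
  using cinner_add_left[of 0 0 y] by simp

lemma cinner_zero_right: "cinner y 0 = 0"
  using cinner_add_right[of y 0 0] by simp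

lemma cinner_sum_right: "cinner x (sum f A) = (\<Sum>i\<in>A. cinner x (f i))"
  by (induction A rule: infinite_finite_induct) (simp_all add: cinner_zero_right cinner_add_right)

text \<open>The class axioms tie complex scalars to the norm through \<open>cinner_self\<close>, so
  homogeneity of the norm is computed from \<open>cinner\<close>.\<close>

lemma bounded_linear_scaleC_right: "bounded_linear (\<lambda>x :: 'h::complex_hilbert. c *\<^sub>C x)"
proof (rule bounded_linear_intro)
  show "c *\<^sub>C (x + y) = c *\<^sub>C x + c *\<^sub>C y" for x y :: 'h
    by (rule scaleC_add_right)
  show "c *\<^sub>C (r *\<^sub>R x) = r *\<^sub>R (c *\<^sub>C x)" for r and x :: 'h
    by (simp add: scaleR_scaleC scaleC_scaleC mult.commute)
  show "norm (c *\<^sub>C x) \<le> norm x * cmod c" for x :: 'h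
  proof -
    have "complex_of_real ((norm (c *\<^sub>C x))\<^sup>2) = c * cnj c * cinner x x"
      by (simp only: cinner_self[symmetric] cinner_scaleC_left cinner_scaleC_right mult.assoc)
    also have "\<dots> = complex_of_real ((cmod c * norm x)\<^sup>2)"
      by (simp only: complex_norm_square[symmetric] cinner_self of_real_mult[symmetric]
          power_mult_distrib)
    finally have "norm (c *\<^sub>C x) = cmod c * norm x"
      by (simp only: of_real_eq_iff) (simp add: power2_eq_iff_nonneg)
    then show ?thesis by (simp add: mult.commute)
  qed
qed

lemma bounded_linear_cinner_scaleC:
  fixes a b :: "'h::complex_hilbert"
  shows "bounded_linear (\<lambda>x. cinner a x *\<^sub>C b)"
proof -
  interpret rinner: bounded_bilinear "rinner :: 'h \<Rightarrow> 'h \<Rightarrow> real"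
    by (rule bounded_bilinear_rinner)
  \<comment> \<open>Splitting the coefficient into real and imaginary parts leaves only maps already
    known to be bounded and real-linear.\<close>
  have "cinner a x *\<^sub>C b = rinner a x *\<^sub>R b - rinner a (\<i> *\<^sub>C x) *\<^sub>R (\<i> *\<^sub>C b)" for x
  proof -
    have "rinner a x *\<^sub>R b - rinner a (\<i> *\<^sub>C x) *\<^sub>R (\<i> *\<^sub>C b)
        = (complex_of_real (Re (cinner a x)) + \<i> * complex_of_real (Im (cinner a x))) *\<^sub>C b"
      by (simp add: scaleR_scaleC scaleC_scaleC Im_cinner mult.commute
          rinner_def complex_module.scale_left_diff_distrib)
    then show ?thesis by (simp flip: complex_eq)
  qed
  then show ?thesis
    by (simp only:) (rule bounded_linear_sub bounded_linear_compose[OF bounded_linear_scaleR_left]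
        rinner.bounded_linear_right bounded_linear_compose[OF rinner.bounded_linear_right]
        bounded_linear_scaleC_right)+
qed

lemma cinner_eq_0_cspan:
  assumes "\<And>y. y \<in> A \<Longrightarrow> cinner y v = 0" and "y \<in> cspan A"
  shows "cinner y v = 0"
  using assms(2)
proof (induction rule: complex_module.span_induct_alt)
  case (step c x z)
  then show ?case by (simp add: assms(1) cinner_add_left cinner_scaleC_left)
qed (rule cinner_zero_left)

text \<open>The finite Fourier sum satisfies the description in \<open>orth_proj\<close>. It is the
  only candidate: the difference of two values lies in the span and is orthogonal to it, hence to
  itself.\<close>

lemma orth_proj_cspan:
  fixes e :: "'i \<Rightarrow> 'h::complex_hilbert"
  assumes orth: "\<And>i j. cinner (e i) (e j) = (if i = j then 1 else 0)" and fin: "finite I"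
  shows "blinfun_apply (orth_proj (cspan (e ` I))) x = (\<Sum>i\<in>I. cinner (e i) x *\<^sub>C e i)"
proof -
  let ?M = "cspan (e ` I)"
  define p where "p x = (\<Sum>i\<in>I. cinner (e i) x *\<^sub>C e i)" for x
  have "bounded_linear p"
    unfolding p_def by (intro bounded_linear_sum bounded_linear_cinner_scaleC)
  then have P: "blinfun_apply (Blinfun p) x = p x" for x
    by (simp add: bounded_linear_Blinfun_apply)
  have p_mem: "p x \<in> ?M" for x
    unfolding p_def
    by (intro complex_module.span_sum complex_module.span_scale complex_module.span_base) simp
  have p_orth: "cinner y (x - p x) = 0" if "y \<in> ?M" for x y
    using _ that
  proof (rule cinner_eq_0_cspan)
    fix z assume "z \<in> e ` I"
    then obtain j where j: "j \<in> I" "z = e j" by blast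
    have "cinner (e j) (p x) = (\<Sum>i\<in>I. if j = i then cinner (e i) x else 0)"
      unfolding p_def cinner_sum_right by (intro sum.cong) (auto simp: cinner_scaleC_right orth)
    then show "cinner z (x - p x) = 0"
      using j fin by (simp add: cinner_diff_right)
  qed
  have "orth_proj ?M = Blinfun p"
    unfolding orth_proj_def
  proof (rule the_equality)
    show "\<forall>x. blinfun_apply (Blinfun p) x \<in> ?M \<and>
        (\<forall>y\<in>?M. cinner y (x - blinfun_apply (Blinfun p) x) = 0)"
      by (simp add: P p_mem p_orth)
    fix Q assume Q: "\<forall>x. blinfun_apply Q x \<in> ?M \<and> (\<forall>y\<in>?M. cinner y (x - blinfun_apply Q x) = 0)"
    show "Q = Blinfun p"
    proof (rule blinfun_eqI)
      fix x
      let ?d = "blinfun_apply Q x - p x"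
      have "?d \<in> ?M"
        using Q p_mem by (blast intro: complex_module.span_diff)
      then have "cinner ?d ((x - p x) - (x - blinfun_apply Q x)) = 0"
        using Q p_orth by (simp only: cinner_diff_right[of ?d "x - p x"]) simp
      then show "blinfun_apply Q x = blinfun_apply (Blinfun p) x"
        by (simp add: P cinner_self)
    qed
  qed
  then show ?thesis by (simp add: P p_def)
qed

lemma orth_proj_cspan_bounded_ops:
  fixes e :: "'i \<Rightarrow> 'h::complex_hilbert"
  assumes "\<And>i j. cinner (e i) (e j) = (if i = j then 1 else 0)" and "finite I"
  shows "orth_proj (cspan (e ` I)) \<in> bounded_ops"
  unfolding bounded_ops_def mem_Collect_eq orth_proj_cspan[OF assms]
  by (simp add: cinner_scaleC_right scaleC_scaleC complex_module.scale_sum_right)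

lemma orth_proj_cspan_basis:
  fixes e :: "'i \<Rightarrow> 'h::complex_hilbert"
  assumes orth: "\<And>i j. cinner (e i) (e j) = (if i = j then 1 else 0)" and "finite I" and "j \<in> I"
  shows "blinfun_apply (orth_proj (cspan (e ` I))) (e j) = e j"
proof -
  have "(\<Sum>i\<in>I. cinner (e i) (e j) *\<^sub>C e i) = (\<Sum>i\<in>I. if i = j then e i else 0)"
    by (intro sum.cong) (auto simp: orth)
  then show ?thesis
    using assms(2,3) by (simp add: orth_proj_cspan[OF orth])
qed

section \<open>Coordinates, the backward shift and lower bounds\<close>

lemma bounded_ops_diff: "S \<in> bounded_ops \<Longrightarrow> T \<in> bounded_ops \<Longrightarrow> S - T \<in> bounded_ops"
  by (simp add: bounded_ops_def blinfun.diff_left complex_module.scale_right_diff_distrib)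

text \<open>For fixed \<open>h\<close>, the functional \<open>T \<mapsto> rinner (T h) h\<close>
  turns the operator series into the nonnegative series of the squared norms of
  \<open>z i h\<close>; one term is at most the total.\<close>

lemma norm_coordinate_le_l2A_norm:
  assumes "\<And>i. z i \<in> bounded_ops" and "(\<lambda>i. adj (z i) o\<^sub>L z i) summable_on UNIV"
  shows "norm (blinfun_apply (z j) h) \<le> l2A_norm z * norm h"
proof -
  interpret rinner: bounded_bilinear "rinner :: 'a \<Rightarrow> 'a \<Rightarrow> real"
    by (rule bounded_bilinear_rinner)
  let ?L = "l2A_inner z z"
  let ?\<phi> = "\<lambda>T. rinner (blinfun_apply T h) h"
  have "bounded_linear ?\<phi>"
    by (intro bounded_linear_compose[OF rinner.bounded_linear_left] blinfun.bounded_linear_left)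
  moreover have "((\<lambda>i. adj (z i) o\<^sub>L z i) has_sum ?L) UNIV"
    using assms(2) by (simp add: l2A_inner_def)
  ultimately have "((\<lambda>i. ?\<phi> (adj (z i) o\<^sub>L z i)) has_sum ?\<phi> ?L) UNIV"
    by (rule has_sum_bounded_linear)
  then have sum: "((\<lambda>i. (norm (blinfun_apply (z i) h))\<^sup>2) has_sum ?\<phi> ?L) UNIV"
    by (simp add: rinner_adj[OF assms(1)] rinner_self)
  have "(norm (blinfun_apply (z j) h))\<^sup>2 \<le> ?\<phi> ?L"
    using has_sum_mono2[OF has_sum_finite[of "{j}"] sum] by simp
  also have "\<dots> \<le> norm ?L * norm h * norm h"
    by (rule order_trans[OF rinner_le_norm]) (intro mult_right_mono norm_blinfun norm_ge_zero)
  also have "\<dots> = (l2A_norm z * norm h)\<^sup>2"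
    by (simp add: l2A_norm_def power_mult_distrib power2_eq_square)
  finally show ?thesis
    by (rule power2_le_imp_le) (simp add: l2A_norm_def)
qed

lemma blinfun_compose_assoc: "(R o\<^sub>L S) o\<^sub>L T = R o\<^sub>L (S o\<^sub>L T)"
  by (intro blinfun_eqI) simp

text \<open>At \<open>\<xi> = j - n\<close> this links the entries of a periodic sequence at
  \<open>j - n\<close> and \<open>j\<close> through the product of inverse weights.\<close>

lemma S_op_power_apply:
  "(S_op U W ^^ n) y \<xi> =
    W_inv_prod W (\<xi> + 1) (\<xi> + int n) o\<^sub>L y (\<xi> + int n) o\<^sub>L ((o\<^sub>L) (adj U) ^^ n) id_blinfun"
proof (induction n arbitrary: \<xi>)
  case 0
  show ?case
    by (intro blinfun_eqI) (simp add: W_inv_prod_def)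
next
  case (Suc n)
  have "[\<xi> + 1..\<xi> + int (Suc n)] = (\<xi> + 1) # [\<xi> + 1 + 1..\<xi> + 1 + int n]"
    by (subst upto_rec1) (simp_all add: algebra_simps)
  then have "W_inv_prod W (\<xi> + 1) (\<xi> + int (Suc n)) =
      inv_op (W (\<xi> + 1)) o\<^sub>L W_inv_prod W (\<xi> + 1 + 1) (\<xi> + 1 + int n)"
    by (simp add: W_inv_prod_def)
  \<comment> \<open>\<open>S_op\<close> appends \<open>adj U\<close> on the right, whereas the
    iterated composition grows on the left.\<close>
  moreover have "((o\<^sub>L) (adj U) ^^ Suc n) id_blinfun = ((o\<^sub>L) (adj U) ^^ n) id_blinfun o\<^sub>L adj U"
  proof (induction n)
    case 0
    show ?case by (intro blinfun_eqI) simp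
  next
    case (Suc n)
    then show ?case by (simp add: blinfun_compose_assoc[symmetric])
  qed
  moreover have "\<xi> + int (Suc n) = \<xi> + 1 + int n"
    by simp
  ultimately show ?case
    by (simp only: funpow.simps(2) o_apply S_op_def[of U W "(S_op U W ^^ n) y"] Suc.IH
        blinfun_compose_assoc)
qed

lemma adj_unitary_power_apply:
  assumes "unitary_op U"
  shows "blinfun_apply (((o\<^sub>L) (adj U) ^^ n) id_blinfun) ((blinfun_apply U ^^ n) v) = v"
proof -
  have adj_pow: "blinfun_apply (((o\<^sub>L) (adj U) ^^ n) id_blinfun) x = (blinfun_apply (adj U) ^^ n) x"
    for n x by (induction n) simp_all
  have "(blinfun_apply (adj U) ^^ n) ((blinfun_apply U ^^ n) v) = v"
  proof (induction n)
    case (Suc n)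
    then show ?case
      \<comment> \<open>Peeling the innermost adjoint lets it cancel the outermost
        \<open>U\<close>.\<close>
      unfolding funpow_Suc_right[of n "blinfun_apply (adj U)"]
      by (simp add: unitary_op_apply(1)[OF assms])
  qed simp
  then show ?thesis by (simp add: adj_pow)
qed

lemma norm_unitary_power_apply:
  assumes "unitary_op U"
  shows "norm ((blinfun_apply U ^^ n) v) = norm v"
  by (induction n) (simp_all add: unitary_op_apply(2)[OF assms])

text \<open>One vector caps every admissible constant:
  \<open>C * a \<le> C * norm h \<le> norm (R h) \<le> b\<close>.\<close>

lemma lower_bound_op_bounds:
  assumes "norm (blinfun_apply R h) \<le> b" and "a \<le> norm h" and "a > 0"
  shows "0 \<le> lower_bound_op R" and "lower_bound_op R \<le> b / a"
proof -
  let ?C = "insert 0 {C. C > 0 \<and> (\<forall>h. norm (blinfun_apply R h) \<ge> C * norm h)}"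
  have "b \<ge> 0" using assms(1) norm_ge_zero order_trans by blast
  have le: "C \<le> b / a" if "C \<in> ?C" for C
  proof (cases "C = 0")
    case True
    then show ?thesis using \<open>b \<ge> 0\<close> \<open>a > 0\<close> by simp
  next
    case False
    then have "C > 0" "C * norm h \<le> norm (blinfun_apply R h)" using that by auto
    then have "C * a \<le> b"
      using assms(1) mult_left_mono[OF assms(2), of C] by linarith
    then show ?thesis using \<open>a > 0\<close> by (simp add: pos_le_divide_eq)
  qed
  show "lower_bound_op R \<le> b / a"
    unfolding lower_bound_op_def by (rule cSup_least) (use le in auto)
  \<comment> \<open>The inserted 0 is a member of the set, and the cap just proved makes the set
    bounded above.\<close>
  show "0 \<le> lower_bound_op R"
    unfolding lower_bound_op_def by (rule cSup_upper[OF _ bdd_aboveI[OF le]]) simp_all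
qed

section \<open>From periodic approximants to a sequence of exponents\<close>

theorem proposition3p8:
  fixes e :: "int \<Rightarrow> 'h::complex_hilbert"
    and W :: "int \<Rightarrow> ('h \<Rightarrow>\<^sub>L 'h)"
    and U :: "'h \<Rightarrow>\<^sub>L 'h"
    and J m :: nat
  assumes "orthonormal_basis e"
    and "\<And>j. W j \<in> bounded_ops" and "\<And>j. invertible_op (W j)"
    and "bounded (range W)" and "bounded (range (\<lambda>j. inv_op (W j)))"
    and "unitary_op U"
    and "J \<ge> 1" and "m \<ge> 1"
  shows "P_tilde e J m \<in> l2A_closure (periodic_elements l2A (S_op U W)) \<longrightarrow>
    (\<exists>n :: nat \<Rightarrow> nat. strict_mono n \<and> (\<forall>k. n k \<ge> 1) \<and>
      (\<forall>j \<in> {- int J..int J}.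
        (\<lambda>k. lower_bound_op (W_inv_prod W (j - int (n k) + 1) j)) \<longlonglongrightarrow> 0))"
proof
  assume closure: "P_tilde e J m \<in> l2A_closure (periodic_elements l2A (S_op U W))"
  have orth: "\<And>i j. cinner (e i) (e j) = (if i = j then 1 else 0)"
    using assms(1) by (simp add: orthonormal_basis_def)
  have norm_e: "norm (e 0) = 1"
  proof -
    have "(norm (e 0))\<^sup>2 = 1"
      using rinner_self[of "e 0"] by (simp add: rinner_def orth)
    then show ?thesis by (simp add: power2_eq_1_iff) (use norm_ge_zero[of "e 0"] in linarith)
  qed
  let ?R = "\<lambda>n j. W_inv_prod W (j - int n + 1) j"
  let ?P = "P_tilde e J m"
  have P_ops: "?P j \<in> bounded_ops" for j
    using orth_proj_cspan_bounded_ops[OF orth] by (simp add: P_tilde_def bounded_ops_def)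
  \<comment> \<open>The vector \<open>e 0\<close> works for every \<open>m\<close>, since 0 lies in
    \<open>{- int m..int m}\<close>.\<close>
  have P_e0: "blinfun_apply (?P j) (e 0) = e 0" if "j \<in> {- int J..int J}" for j
    using that by (simp add: P_tilde_def orth_proj_cspan_basis[OF orth])
  have key: "\<exists>n>B. \<forall>j\<in>{- int J..int J}.
      0 \<le> lower_bound_op (?R n j) \<and> lower_bound_op (?R n j) \<le> \<epsilon> / (1 - \<epsilon>)"
    if "0 < \<epsilon>" "\<epsilon> < 1" for \<epsilon> :: real and B :: nat
  proof -
    obtain y where y: "y \<in> periodic_elements l2A (S_op U W)" "l2A_norm (\<lambda>j. y j - ?P j) < \<epsilon>"
      using closure \<open>0 < \<epsilon>\<close> unfolding l2A_closure_def by blast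
    then obtain N where N: "N \<ge> 1" "\<And>k. k \<ge> 1 \<Longrightarrow> (S_op U W ^^ (k * N)) y = y"
      unfolding periodic_elements_def by blast
    \<comment> \<open>As \<open>N \<ge> 1\<close>, this multiple of the period exceeds both
      \<open>B\<close>, for strict growth later, and \<open>2 * J\<close>, so that
      \<open>j - n\<close> leaves the support of \<open>P_tilde\<close>.\<close>
    define n where "n = (B + 2 * J + 1) * N"
    have "B + 2 * J + 1 \<le> n"
      using mult_le_mono2[OF N(1), of "B + 2 * J + 1"] unfolding n_def by simp
    then have n: "n > B" "n > 2 * J" by simp_all
    have per: "(S_op U W ^^ n) y = y"
      unfolding n_def by (rule N(2)) simp
    define z where "z j = y j - ?P j" for j
    have y_l2A: "y \<in> l2A"
      using y(1) by (simp add: periodic_elements_def)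
    have z_ops: "z j \<in> bounded_ops" for j
      using y_l2A unfolding z_def by (intro bounded_ops_diff P_ops) (simp add: l2A_def compact_ops_def)
    \<comment> \<open>Without summability, \<open>l2A_inner z z\<close> would be the default value 0
      and bound nothing. It passes from \<open>y\<close> to \<open>z\<close> because they agree off
      a finite set.\<close>
    have z_sum: "(\<lambda>j. adj (z j) o\<^sub>L z j) summable_on UNIV"
    proof -
      let ?F = "{- int J..int J}"
      have "(\<lambda>j. adj (y j) o\<^sub>L y j) summable_on (UNIV - ?F)"
        using y_l2A by (intro summable_on_cofin_subset) (auto simp: l2A_def)
      then have "(\<lambda>j. adj (z j) o\<^sub>L z j) summable_on (UNIV - ?F)"
        by (rule summable_on_cong[THEN iffD1, rotated]) (auto simp: z_def P_tilde_def)
      moreover have "(\<lambda>j. adj (z j) o\<^sub>L z j) summable_on ?F"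
        by (rule summable_on_finite) simp
      ultimately have "(\<lambda>j. adj (z j) o\<^sub>L z j) summable_on ((UNIV - ?F) \<union> ?F)"
        by (rule summable_on_Un_disjoint) auto
      then show ?thesis by simp
    qed
    have z_le: "norm (blinfun_apply (z j) h) \<le> \<epsilon>" if "norm h = 1" for j h
      using norm_coordinate_le_l2A_norm[OF z_ops z_sum, of j h] y(2) that by (simp add: z_def)
    have "0 \<le> lower_bound_op (?R n j) \<and> lower_bound_op (?R n j) \<le> \<epsilon> / (1 - \<epsilon>)"
      if j: "j \<in> {- int J..int J}" for j
    proof -
      let ?h = "blinfun_apply (y j) (e 0)"
      let ?v = "(blinfun_apply U ^^ n) (e 0)"
      have "y (j - int n) = ?R n j o\<^sub>L y j o\<^sub>L ((o\<^sub>L) (adj U) ^^ n) id_blinfun"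
        using S_op_power_apply[of n U W y "j - int n"] unfolding per by simp
      then have "blinfun_apply (y (j - int n)) ?v = blinfun_apply (?R n j) ?h"
        by (simp add: adj_unitary_power_apply[OF assms(6)])
      \<comment> \<open>Here \<open>j - int n < - int J\<close>, so the entry of
        \<open>P_tilde\<close> is 0 and all of \<open>y (j - int n)\<close> is error.\<close>
      moreover have "z (j - int n) = y (j - int n)"
        using j n(2) by (simp add: z_def P_tilde_def)
      moreover have "norm ?v = 1"
        by (simp add: norm_unitary_power_apply[OF assms(6)] norm_e)
      ultimately have small: "norm (blinfun_apply (?R n j) ?h) \<le> \<epsilon>"
        using z_le[of ?v "j - int n"] by simp
      have "norm (?h - e 0) \<le> \<epsilon>"
        using z_le[OF norm_e, of j] by (simp add: z_def blinfun.diff_left P_e0[OF j])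
      then have "1 - \<epsilon> \<le> norm ?h"
        using norm_triangle_ineq2[of "e 0" ?h] by (simp add: norm_e norm_minus_commute)
      then show ?thesis
        using lower_bound_op_bounds[OF small] \<open>\<epsilon> < 1\<close> by simp
    qed
    then show ?thesis using n(1) by blast
  qed
  let ?good = "\<lambda>k n. n \<ge> 1 \<and> (\<forall>j\<in>{- int J..int J}.
      0 \<le> lower_bound_op (?R n j) \<and> lower_bound_op (?R n j) \<le> 1 / real (Suc k))"
  have step: "\<exists>n>B. ?good k n" for k B :: nat
  proof -
    \<comment> \<open>This value solves \<open>\<epsilon> / (1 - \<epsilon>) = 1 / (k + 1)\<close>
      and stays below 1 even for \<open>k = 0\<close>.\<close>
    let ?\<epsilon> = "1 / real (k + 2)"
    have "?\<epsilon> / (1 - ?\<epsilon>) = 1 / real (Suc k)"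
      by (simp add: field_simps)
    then show ?thesis
      using key[of ?\<epsilon> B] by fastforce
  qed
  \<comment> \<open>In \<open>step\<close> the bound \<open>B\<close> is arbitrary; taking it to be
    the previous exponent makes the sequence strictly increasing.\<close>
  obtain n where n: "\<And>k. ?good k (n k)" "\<And>k. n k < n (Suc k)"
    using dependent_nat_choice[of ?good "\<lambda>_. (<)"] step by metis
  have "(\<lambda>k. lower_bound_op (?R (n k) j)) \<longlonglongrightarrow> 0" if "j \<in> {- int J..int J}" for j
  proof (rule tendsto_sandwich[where f = "\<lambda>_. 0" and h = "\<lambda>k. 1 / real (Suc k)"])
    show "(\<lambda>k. 1 / real (Suc k)) \<longlonglongrightarrow> 0"
      using LIMSEQ_Suc[OF lim_1_over_n] by simp
  qed (use n(1) that in auto)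
  then show "\<exists>n :: nat \<Rightarrow> nat. strict_mono n \<and> (\<forall>k. n k \<ge> 1) \<and>
      (\<forall>j \<in> {- int J..int J}. (\<lambda>k. lower_bound_op (?R (n k) j)) \<longlonglongrightarrow> 0)"
    using n by (intro exI[of _ n]) (auto simp: strict_mono_Suc_iff)
qed

end
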